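(* Let $\alpha_1,\alpha_2\in[0,1/2]\setminus\mathbb{Q}$ and let $I_1,I_2\subset S^1$ be finite unions of closed intervals with nonempty interiors, each different from $\emptyset$ and from $S^1$, and each having no rotational symmetries. Then the itinerary of $0$ under $r_{\alpha_1}$ relative to $I_1$ and the itinerary of $0$ under $r_{\alpha_2}$ relative to $I_2$ are the same if and only if $\alpha_1=\alpha_2$ and $I_1=I_2$.
   Context: $S^1=\mathbb{R}/\mathbb{Z}$. For $\alpha\in\mathbb{R}$, $r_\alpha:S^1\to S^1$ is the rotation $r_\alpha(z)=z+\alpha \bmod 1$. A closed interval in $S^1$ is a closed arc. For $I\subset S^1$, the itinerary of $0$ under $r_\alpha$ relative to $I$ is the sequence $(a_0,a_1,a_2,\ldots)$ with $a_i=1$ if $r_\alpha^i(0)\in I$ and $a_i=0$ otherwise. For a positive integer $n$, $I$ has $n$-fold rotational symmetry if $I+1/n=I$ in $\mathbb{R}/\mathbb{Z}$; $I$ has no rotational symmetries if it does not have $n$-fold rotational symmetry for any integer $n\ge 2$. *)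

theory Defs
  imports "HOL-Analysis.Analysis"
begin

quotient_type circle = real / "\<lambda>x y :: real. x - y \<in> \<int>"
proof (rule equivpI)
  show "reflp (\<lambda>x y :: real. x - y \<in> \<int>)"
    by (simp add: reflp_def)
  show "symp (\<lambda>x y :: real. x - y \<in> \<int>)"
    unfolding symp_def by (metis Ints_minus minus_diff_eq)
  show "transp (\<lambda>x y :: real. x - y \<in> \<int>)"
    unfolding transp_def
  proof (intro allI impI)
    fix x y z :: real
    assume "x - y \<in> \<int>" "y - z \<in> \<int>"
    from Ints_add[OF this] show "x - z \<in> \<int>" by simp
  qed
qed

lift_definition proj_circle :: "real \<Rightarrow> circle" is "\<lambda>x. x" .

lemma proj_circle_eq_iff: "proj_circle x = proj_circle y \<longleftrightarrow> x - y \<in> \<int>"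
  by transfer simp

lemma surj_proj_circle: "surj proj_circle"
  unfolding surj_def
proof
  fix z :: circle
  show "\<exists>x. z = proj_circle x"
    by transfer (metis Ints_0 diff_self)
qed

instantiation circle :: topological_space
begin

definition open_circle :: "circle set \<Rightarrow> bool"
  where "open_circle U \<longleftrightarrow> open (proj_circle -` U)"

instance
  by standard (auto simp: open_circle_def vimage_Union)

end

lift_definition rotation :: "real \<Rightarrow> circle \<Rightarrow> circle" is "\<lambda>\<alpha> x. x + \<alpha>"
  by simp

lemma rotation_proj_circle: "rotation \<alpha> (proj_circle x) = proj_circle (x + \<alpha>)"
  by transfer simp

text \<open>Arcs are proper here; the whole circle is still a union of two of them.\<close>

definition closed_arc :: "circle set \<Rightarrow> bool"
  where "closed_arc A \<longleftrightarrow> (\<exists>a b. a \<le> b \<and> b < a + 1 \<and> A = proj_circle ` {a..b})"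

definition finite_union_of_fat_arcs :: "circle set \<Rightarrow> bool"
  where "finite_union_of_fat_arcs I \<longleftrightarrow>
    (\<exists>\<A>. finite \<A> \<and> (\<forall>A\<in>\<A>. closed_arc A \<and> interior A \<noteq> {}) \<and> I = \<Union>\<A>)"

definition rotational_symmetry :: "nat \<Rightarrow> circle set \<Rightarrow> bool"
  where "rotational_symmetry n I \<longleftrightarrow> n > 0 \<and> rotation (1 / real n) ` I = I"

definition no_rotational_symmetries :: "circle set \<Rightarrow> bool"
  where "no_rotational_symmetries I \<longleftrightarrow> (\<forall>n\<ge>2. \<not> rotational_symmetry n I)"

definition itinerary :: "real \<Rightarrow> circle set \<Rightarrow> nat \<Rightarrow> nat"
  where "itinerary \<alpha> I i = (if (rotation \<alpha> ^^ i) (proj_circle 0) \<in> I then 1 else 0)"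

end

(* If n*a1 -> 0 and n*a2 -> k modulo 1 along naturals n, then translation by k maps I2 into
   itself: a point m*a1 off the finite boundary of I1 stays on the same side of it when moved by a
   small n*a1, so m*a2 in I2 forces m*a2 + k in I2 for almost all m. If k is irrational, this makes
   I2 the whole circle; if k = a/b in lowest terms, I2 has b-fold symmetry. So k must be 0.

   If 1, a1, a2 are rationally independent, Kronecker's theorem gives such a k = 1/2. Otherwise let
   p*a1 + q*a2 + r = 0 with q > 0. Approximating 1/q by multiples n'*a1 and taking n = q*n' gives
   k = -p/q, hence q divides p; approximating 0 by n*a1 with n = 1 modulo q gives k = -r/q, hence q
   divides r. Thus a2 is an integer combination of a1 and 1, and by symmetry a1 of a2 and 1, so
   a2 = a1 or a2 = -a1 modulo 1. *)

theory Submission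
  imports Defs
begin

section \<open>Lifts of unions of arcs to the line\<close>

text \<open>Sets on the circle are replaced by their periodic lifts to the line. The four conditions
  record what the argument uses of a union of fat arcs: closedness, regularity, periodicity, and
  boundary points in finitely many classes modulo 1.\<close>

definition arc_lift :: "real set \<Rightarrow> bool"
  where "arc_lift J \<longleftrightarrow> closed J \<and> J \<subseteq> closure (interior J) \<and>
    (\<forall>x. \<forall>n::int. x + of_int n \<in> J \<longleftrightarrow> x \<in> J) \<and>
    (\<exists>F. finite F \<and> (\<forall>x\<in>J - interior J. \<exists>f\<in>F. x - f \<in> \<int>))"

lemma arc_lift_periodic: "arc_lift J \<Longrightarrow> x + of_int n \<in> J \<longleftrightarrow> x \<in> J"
  by (simp add: arc_lift_def)

lemma arc_lift_empty: "arc_lift {}"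
  by (auto simp: arc_lift_def)

lemma arc_lift_Un:
  assumes "arc_lift J" "arc_lift K"
  shows "arc_lift (J \<union> K)"
proof -
  obtain F G where "finite F" and F: "\<And>x. x \<in> J - interior J \<Longrightarrow> \<exists>f\<in>F. x - f \<in> \<int>"
    and "finite G" and G: "\<And>x. x \<in> K - interior K \<Longrightarrow> \<exists>f\<in>G. x - f \<in> \<int>"
    using assms unfolding arc_lift_def by metis
  have int: "interior J \<subseteq> interior (J \<union> K)" "interior K \<subseteq> interior (J \<union> K)"
    by (auto intro!: interior_mono)
  have "\<exists>f\<in>F \<union> G. x - f \<in> \<int>" if "x \<in> J \<union> K - interior (J \<union> K)" for x
    using that int F[of x] G[of x] by blast
  moreover have "J \<union> K \<subseteq> closure (interior (J \<union> K))"
    using assms closure_mono[OF int(1)] closure_mono[OF int(2)] unfolding arc_lift_def by blast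
  moreover have "finite (F \<union> G)" using \<open>finite F\<close> \<open>finite G\<close> by simp
  ultimately show ?thesis
    using assms unfolding arc_lift_def by blast
qed

lemma arc_lift_arc:
  assumes "a < b"
  shows "arc_lift (proj_circle -` proj_circle ` {a..b})" (is "arc_lift ?J")
proof -
  have J: "x \<in> ?J \<longleftrightarrow> (\<exists>i::int. a + of_int i \<le> x \<and> x \<le> b + of_int i)" for x
  proof
    assume "x \<in> ?J"
    then obtain y where "y \<in> {a..b}" "x - y \<in> \<int>" by (auto simp: proj_circle_eq_iff)
    then obtain i where "x - y = of_int i" by (auto elim: Ints_cases)
    with \<open>y \<in> {a..b}\<close> show "\<exists>i::int. a + of_int i \<le> x \<and> x \<le> b + of_int i"
      by (intro exI[of _ i]) auto
  next
    assume "\<exists>i::int. a + of_int i \<le> x \<and> x \<le> b + of_int i"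
    then obtain i :: int where "a + of_int i \<le> x" "x \<le> b + of_int i" by blast
    then have "x - of_int i \<in> {a..b}" "proj_circle x = proj_circle (x - of_int i)"
      by (auto simp: proj_circle_eq_iff)
    then show "x \<in> ?J" by (metis imageI vimageI)
  qed
  have int: "{a + of_int i<..<b + of_int i} \<subseteq> interior ?J" for i :: int
  proof (rule interior_maximal)
    show "{a + of_int i<..<b + of_int i} \<subseteq> ?J"
    proof
      fix x assume "x \<in> {a + of_int i<..<b + of_int i}"
      then show "x \<in> ?J" unfolding J by (intro exI[of _ i]) simp
    qed
  qed simp
  \<comment> \<open>An infinite union of closed intervals need not be closed, but the sum of a
    compact set and the closed set \<open>\<int>\<close> is.\<close>
  have "?J = (\<Union>x\<in>{a..b}. \<Union>y\<in>\<int>. {x + y})"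
  proof (intro set_eqI iffI)
    fix x assume "x \<in> ?J"
    then obtain i :: int where "a + of_int i \<le> x" "x \<le> b + of_int i" unfolding J by blast
    then show "x \<in> (\<Union>x\<in>{a..b}. \<Union>y\<in>\<int>. {x + y})"
      by (intro UN_I[of "x - of_int i"] UN_I[of "of_int i"]) auto
  next
    fix x assume "x \<in> (\<Union>x\<in>{a..b}. \<Union>y\<in>\<int>. {x + y})"
    then obtain y i where "y \<in> {a..b}" "x = y + of_int i" by (auto elim!: Ints_cases)
    then show "x \<in> ?J" unfolding J by (intro exI[of _ i]) simp
  qed
  then have "closed ?J"
    by (simp add: compact_closed_sums closed_Ints)
  moreover have "?J \<subseteq> closure (interior ?J)"
  proof
    fix x assume "x \<in> ?J"
    then obtain i :: int where "x \<in> {a + of_int i..b + of_int i}"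
      unfolding J by auto
    also have "\<dots> = closure {a + of_int i<..<b + of_int i}" using assms by simp
    also have "\<dots> \<subseteq> closure (interior ?J)" by (rule closure_mono[OF int])
    finally show "x \<in> closure (interior ?J)" .
  qed
  moreover have "x + of_int n \<in> ?J \<longleftrightarrow> x \<in> ?J" for x and n :: int
  proof -
    have "proj_circle (x + of_int n) = proj_circle x" by (simp add: proj_circle_eq_iff)
    then show ?thesis by simp
  qed
  moreover have "\<exists>f\<in>{a, b}. x - f \<in> \<int>" if x: "x \<in> ?J - interior ?J" for x
  proof -
    obtain i :: int where "a + of_int i \<le> x" "x \<le> b + of_int i" using x J by blast
    moreover have "x \<notin> {a + of_int i<..<b + of_int i}" using x int by blast
    ultimately have "x - a = of_int i \<or> x - b = of_int i" by auto
    then show ?thesis by auto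
  qed
  ultimately show ?thesis
    unfolding arc_lift_def by (intro conjI allI exI[of _ "{a, b}"] ballI) simp_all
qed

text \<open>Nonempty interior rules out one-point arcs, so every arc comes from an interval with
  \<open>a < b\<close>; finite unions follow by induction.\<close>

lemma arc_lift_vimage:
  assumes "finite_union_of_fat_arcs I"
  shows "arc_lift (proj_circle -` I)"
proof -
  obtain \<A> where "finite \<A>" and arcs: "\<And>A. A \<in> \<A> \<Longrightarrow> closed_arc A \<and> interior A \<noteq> {}"
    and I: "I = \<Union>\<A>"
    using assms unfolding finite_union_of_fat_arcs_def by auto
  have arc: "arc_lift (proj_circle -` A)" if "closed_arc A" "interior A \<noteq> {}" for A
  proof -
    obtain a b where ab: "a \<le> b" "A = proj_circle ` {a..b}"
      using \<open>closed_arc A\<close> unfolding closed_arc_def by blast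
    have "a < b"
    proof (rule ccontr)
      assume "\<not> a < b"
      with ab have A: "A = {proj_circle a}" by simp
      have "open (proj_circle -` interior A)"
        using open_interior[of A] by (simp add: open_circle_def)
      moreover obtain y where "y \<in> proj_circle -` interior A"
        using \<open>interior A \<noteq> {}\<close> surj_proj_circle by (metis ex_in_conv surjD vimageI)
      ultimately obtain e where "e > 0" and e: "\<And>z. dist z y < e \<Longrightarrow> z \<in> proj_circle -` interior A"
        by (metis open_dist)
      \<comment> \<open>The bound \<open>e / 2\<close> keeps \<open>y + d\<close> in the open lift,
        so \<open>y\<close> and \<open>y + d\<close> represent the single point of \<open>A\<close>;
        the bound \<open>1 / 2\<close> keeps \<open>d\<close> from being an integer.\<close>
      define d where "d = min (e / 2) (1 / 2)"
      have d: "0 < d" "d < e" "d < 1" using \<open>e > 0\<close> by (auto simp: d_def)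
      have "proj_circle (y + d) = proj_circle a" "proj_circle y = proj_circle a"
        using e[of y] e[of "y + d"] d \<open>e > 0\<close> interior_subset[of A] A by (auto simp: dist_real_def)
      then have "y + d - y \<in> \<int>" by (metis proj_circle_eq_iff)
      then have "d \<in> \<int>" by simp
      then show False using d by (auto elim!: Ints_cases)
    qed
    with arc_lift_arc ab show ?thesis by blast
  qed
  show ?thesis
    using \<open>finite \<A>\<close> arcs unfolding I
  proof (induction)
    case empty
    then show ?case by (simp add: arc_lift_empty)
  next
    case (insert A \<A>)
    then show ?case using arc[of A] by (simp add: vimage_Un arc_lift_Un)
  qed
qed

section \<open>Translations of the second set\<close>

text \<open>Density gives a positive multiple close to \<open>a - N * \<theta>\<close> modulo 1;
  adding \<open>N\<close> to the index undoes the shift and makes the index large.\<close>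

lemma dense_large_multiples:
  fixes \<theta> a \<epsilon> :: real
  assumes "\<theta> \<notin> \<rat>" "\<epsilon> > 0"
  obtains n h where "n \<ge> N" "\<bar>real n * \<theta> - of_int h - a\<bar> < \<epsilon>"
proof -
  obtain k h where "k > 0" and k: "\<bar>of_int k * \<theta> - of_int h - (a - real N * \<theta>)\<bar> < \<epsilon>"
    using sequence_of_fractional_parts_is_dense[OF assms] by blast
  have "\<bar>real (N + nat k) * \<theta> - of_int h - a\<bar> < \<epsilon>"
    using k \<open>k > 0\<close> by (simp add: algebra_simps)
  then show thesis using that[of "N + nat k" h] by simp
qed

lemma irrational_orbit_inj:
  fixes \<theta> f :: real
  assumes "\<theta> \<notin> \<rat>" "real m * \<theta> - f \<in> \<int>" "real n * \<theta> - f \<in> \<int>"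
  shows "m = n"
proof (rule ccontr)
  assume "m \<noteq> n"
  have "(real m * \<theta> - f) - (real n * \<theta> - f) \<in> \<rat>"
    using Ints_diff[OF assms(2,3)] Ints_subset_Rats by blast
  then have "(real m - real n) * \<theta> \<in> \<rat>" by (simp add: algebra_simps)
  then have "(real m - real n) * \<theta> / (real m - real n) \<in> \<rat>"
    by (intro Rats_divide Rats_diff) auto
  with \<open>m \<noteq> n\<close> assms(1) show False by simp
qed

text \<open>The point \<open>(0, k)\<close> of the torus is a limit of the forward orbit of \<open>(\<alpha>, \<beta>)\<close>.\<close>

definition joint_limit :: "real \<Rightarrow> real \<Rightarrow> real \<Rightarrow> bool"
  where "joint_limit \<alpha> \<beta> k \<longleftrightarrow> (\<forall>\<epsilon>>0. \<exists>n::nat. \<exists>i j::int.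
    \<bar>real n * \<alpha> - of_int i\<bar> < \<epsilon> \<and> \<bar>real n * \<beta> - of_int j - k\<bar> < \<epsilon>)"

text \<open>The boundary points of \<open>J\<close> fill only finitely many classes modulo 1, and an
  irrational orbit visits each class at most once.\<close>

lemma orbit_in_interior:
  assumes J: "arc_lift J" and "\<alpha> \<notin> \<rat>"
  obtains N where "\<And>n. n \<ge> N \<Longrightarrow> real n * \<alpha> \<in> J \<Longrightarrow> real n * \<alpha> \<in> interior J"
proof -
  obtain F where "finite F" and F: "\<And>x. x \<in> J - interior J \<Longrightarrow> \<exists>f\<in>F. x - f \<in> \<int>"
    using J unfolding arc_lift_def by metis
  define B where "B = (\<Union>f\<in>F. {n. real n * \<alpha> - f \<in> \<int>})"
  have "finite {n. real n * \<alpha> - f \<in> \<int>}" for f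
  proof (cases "\<exists>m. real m * \<alpha> - f \<in> \<int>")
    case True
    then obtain m where "real m * \<alpha> - f \<in> \<int>" by blast
    then have "{n. real n * \<alpha> - f \<in> \<int>} \<subseteq> {m}"
      using irrational_orbit_inj[OF \<open>\<alpha> \<notin> \<rat>\<close>] by blast
    then show ?thesis using finite_subset by blast
  qed simp
  then have "finite B" using \<open>finite F\<close> by (simp add: B_def)
  then obtain N where N: "\<And>n. n \<in> B \<Longrightarrow> n < N" by (meson finite_nat_bounded lessThan_iff subsetD)
  show thesis
  proof (rule that[of N], rule ccontr)
    fix n assume "n \<ge> N" "real n * \<alpha> \<in> J" "real n * \<alpha> \<notin> interior J"
    then have "n \<in> B" using F unfolding B_def by blast
    with N[of n] \<open>n \<ge> N\<close> show False by simp
  qed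
qed

text \<open>The claim is shown first for late orbit points of \<beta>, then for interior points by
  density, and finally for all of \<open>J2\<close>, which is closed and lies in the closure of its
  interior.\<close>

lemma translation_closed:
  assumes J1: "arc_lift J1" and J2: "arc_lift J2" and "\<alpha> \<notin> \<rat>" "\<beta> \<notin> \<rat>"
    and orbit: "\<And>n. real n * \<alpha> \<in> J1 \<longleftrightarrow> real n * \<beta> \<in> J2"
    and k: "joint_limit \<alpha> \<beta> k" and "x \<in> J2"
  shows "x + k \<in> J2"
proof -
  have closed: "closed J2" and reg: "J2 \<subseteq> closure (interior J2)"
    using J2 by (auto simp: arc_lift_def)
  obtain N where N: "\<And>n. n \<ge> N \<Longrightarrow> real n * \<alpha> \<in> J1 \<Longrightarrow> real n * \<alpha> \<in> interior J1"
    using orbit_in_interior[OF J1 \<open>\<alpha> \<notin> \<rat>\<close>] by blast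
  have step: "real m * \<beta> + k \<in> J2" if "m \<ge> N" "real m * \<beta> \<in> J2" for m
  proof -
    have "real m * \<alpha> \<in> interior J1" using N orbit that by blast
    then obtain d where "d > 0" and d: "\<And>z. dist z (real m * \<alpha>) < d \<Longrightarrow> z \<in> J1"
      by (metis mem_interior dist_commute mem_ball subsetD)
    have "\<exists>y\<in>J2. dist y (real m * \<beta> + k) < e" if "e > 0" for e
    proof -
      obtain n i j where i: "\<bar>real n * \<alpha> - of_int i\<bar> < min d e"
        and j: "\<bar>real n * \<beta> - of_int j - k\<bar> < min d e"
        using k \<open>d > 0\<close> \<open>e > 0\<close> unfolding joint_limit_def by (metis min_less_iff_conj)
      \<comment> \<open>The joint approximation moves \<open>m * \<alpha>\<close> by less than
        \<open>d\<close> modulo 1, so index \<open>m + n\<close> still lands in \<open>J1\<close>;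
        \<open>orbit\<close> carries this over to \<open>J2\<close>, where the point is near
        \<open>m * \<beta> + k\<close>.\<close>
      have "real (m + n) * \<alpha> + of_int (- i) \<in> J1"
        using i by (intro d) (simp add: dist_real_def algebra_simps)
      then have "real (m + n) * \<beta> + of_int (- j) \<in> J2"
        using orbit arc_lift_periodic[OF J1] arc_lift_periodic[OF J2] by blast
      moreover have "dist (real (m + n) * \<beta> + of_int (- j)) (real m * \<beta> + k) < e"
        using j by (simp add: dist_real_def algebra_simps)
      ultimately show ?thesis by blast
    qed
    then show ?thesis using closed closed_approachable by blast
  qed
  have "y + k \<in> J2" if y: "y \<in> interior J2" for y
  proof -
    obtain d where "d > 0" and d: "\<And>z. dist z y < d \<Longrightarrow> z \<in> J2"
      by (metis y mem_interior dist_commute mem_ball subsetD)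
    have "\<exists>z\<in>J2. dist z (y + k) < e" if "e > 0" for e
    proof -
      \<comment> \<open>Closeness within \<open>d\<close> puts the orbit point into
        \<open>J2\<close>, and an index of at least \<open>N\<close> makes \<open>step\<close>
        applicable.\<close>
      obtain n h where "n \<ge> N" and h: "\<bar>real n * \<beta> - of_int h - y\<bar> < min d e"
        using dense_large_multiples[OF \<open>\<beta> \<notin> \<rat>\<close>, of "min d e" N y] \<open>d > 0\<close> \<open>e > 0\<close> by auto
      have "real n * \<beta> + of_int (- h) \<in> J2"
        using h by (intro d) (simp add: dist_real_def algebra_simps)
      then have "real n * \<beta> + k \<in> J2"
        using step \<open>n \<ge> N\<close> arc_lift_periodic[OF J2] by blast
      then have "real n * \<beta> + k + of_int (- h) \<in> J2"
        using arc_lift_periodic[OF J2] by blast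
      moreover have "dist (real n * \<beta> + k + of_int (- h)) (y + k) < e"
        using h by (simp add: dist_real_def algebra_simps)
      ultimately show ?thesis by blast
    qed
    then show ?thesis using closed closed_approachable by blast
  qed
  then have "interior J2 \<subseteq> (\<lambda>y. y + k) -` J2" by blast
  moreover have "closed ((\<lambda>y. y + k) -` J2)"
    using closed by (intro closed_vimage) (auto intro!: continuous_intros)
  ultimately have "closure (interior J2) \<subseteq> (\<lambda>y. y + k) -` J2"
    by (rule closure_minimal)
  then show ?thesis using reg \<open>x \<in> J2\<close> by blast
qed

section \<open>Translations that map a union of arcs into itself\<close>

lemma multiple_translation:
  fixes k :: real
  assumes "\<And>x. x \<in> J \<Longrightarrow> x + k \<in> J" "x \<in> J"
  shows "x + real n * k \<in> J"
proof (induction n)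
  case (Suc n)
  then show ?case using assms(1)[OF Suc] by (simp add: algebra_simps)
qed (simp add: assms(2))

lemma rotation_image_eq:
  assumes "\<And>x. proj_circle x \<in> I \<Longrightarrow> proj_circle (x + c) \<in> I"
    and "\<And>x. proj_circle x \<in> I \<Longrightarrow> proj_circle (x - c) \<in> I"
  shows "rotation c ` I = I"
proof (intro set_eqI iffI)
  fix z assume "z \<in> rotation c ` I"
  then obtain w where "w \<in> I" "z = rotation c w" by blast
  then show "z \<in> I" using assms(1) surj_proj_circle by (metis rotation_proj_circle surjD)
next
  fix z assume "z \<in> I"
  obtain x where x: "z = proj_circle x" using surj_proj_circle by (metis surjD)
  show "z \<in> rotation c ` I"
  proof (rule image_eqI)
    show "z = rotation c (proj_circle (x - c))" by (simp add: x rotation_proj_circle)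
    show "proj_circle (x - c) \<in> I" using assms(2) x \<open>z \<in> I\<close> by simp
  qed
qed

text \<open>Natural multiples of \<open>k\<close> also preserve the lift. Modulo 1 they are dense if
  \<open>k\<close> is irrational, and they comprise all multiples of \<open>1 / b\<close> if
  \<open>k = a / b\<close> in lowest terms.\<close>

lemma translation_integer:
  assumes I: "finite_union_of_fat_arcs I" "I \<noteq> {}" "I \<noteq> UNIV" "no_rotational_symmetries I"
    and k: "\<And>x. x \<in> proj_circle -` I \<Longrightarrow> x + k \<in> proj_circle -` I"
  shows "k \<in> \<int>"
proof -
  define J where "J = proj_circle -` I"
  have J: "arc_lift J" unfolding J_def by (rule arc_lift_vimage[OF I(1)])
  have mult: "x + real n * k \<in> J" if "x \<in> J" for x n
    using multiple_translation[of J k x n] k that by (auto simp: J_def)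
  have "k \<in> \<rat>"
  proof (rule ccontr)
    assume "k \<notin> \<rat>"
    obtain x where "x \<in> J"
      using \<open>I \<noteq> {}\<close> surj_proj_circle unfolding J_def by (metis ex_in_conv surjD vimageI)
    have "y \<in> J" for y
    proof -
      have "\<exists>z\<in>J. dist z y < e" if "e > 0" for e
      proof -
        obtain n h where h: "\<bar>real n * k - of_int h - (y - x)\<bar> < e"
          using dense_large_multiples[OF \<open>k \<notin> \<rat>\<close> \<open>e > 0\<close>, of 0 "y - x"] by auto
        have "x + real n * k + of_int (- h) \<in> J"
          using mult[OF \<open>x \<in> J\<close>] arc_lift_periodic[OF J] by blast
        moreover have "dist (x + real n * k + of_int (- h)) y < e"
          using h by (simp add: dist_real_def algebra_simps)
        ultimately show ?thesis by blast
      qed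
      then show ?thesis using J closed_approachable unfolding arc_lift_def by blast
    qed
    then have "I = UNIV" using surj_proj_circle unfolding J_def by (metis UNIV_eq_I surjD vimageE)
    with \<open>I \<noteq> UNIV\<close> show False ..
  qed
  then obtain a b :: int where "b > 0" "coprime a b" and kab: "k = of_int a / of_int b"
    by (auto elim: Rats_cases')
  have "b = 1"
  proof (rule ccontr)
    assume "b \<noteq> 1"
    with \<open>b > 0\<close> have "b \<ge> 2" by simp
    obtain u v where uv: "u * a + v * b = 1"
      using bezout_int[of a b] \<open>coprime a b\<close> by auto
    have shift: "x + of_int c / of_int b \<in> J" if "x \<in> J" for x and c :: int
    proof -
      \<comment> \<open>Bezout suggests translating \<open>u * c\<close> times by \<open>k\<close>,
        but the number of steps must be natural. Reducing it modulo \<open>b\<close> changes the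
        translation by an integer only, which \<open>t\<close> absorbs.\<close>
      define n where "n = nat ((u * c) mod b)"
      have n: "int n = (u * c) mod b" using \<open>b > 0\<close> by (simp add: n_def)
      obtain w where w: "u * c = b * w + int n" unfolding n by (metis mult_div_mod_eq)
      define t where "t = v * c + a * w"
      have "a * int n + b * t = a * (b * w + int n) + b * v * c"
        by (simp add: t_def algebra_simps)
      also have "\<dots> = (u * a + v * b) * c" unfolding w[symmetric] by (simp add: algebra_simps)
      finally have t: "c = a * int n + b * t" using uv by simp
      have "x + real n * k + of_int t = x + of_int (a * int n + b * t) / of_int b"
        using \<open>b > 0\<close> by (simp add: kab field_simps)
      moreover have "x + real n * k + of_int t \<in> J"
        using mult[OF that] arc_lift_periodic[OF J] by simp
      ultimately show ?thesis unfolding t by (simp only:)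
    qed
    define n where "n = nat b"
    have "n \<ge> 2" and nb: "real n = of_int b" using \<open>b \<ge> 2\<close> by (auto simp: n_def)
    have "rotation (1 / real n) ` I = I"
      using shift[of _ 1] shift[of _ "-1"] by (intro rotation_image_eq) (auto simp: J_def nb)
    with \<open>n \<ge> 2\<close> I(4) show False
      by (auto simp: no_rotational_symmetries_def rotational_symmetry_def)
  qed
  then show ?thesis by (simp add: kab)
qed

section \<open>Arithmetic of the rotation numbers\<close>

text \<open>Kronecker's theorem reaches any target pair. In \<open>(0, 1/2)\<close> the second entry
  is not an integer, and it equals its negative modulo 1, so an approximating integer multiple of
  either sign can be made natural.\<close>

lemma joint_limit_half:
  assumes indep: "\<And>p q r :: int. of_int p * \<alpha> + of_int q * \<beta> + of_int r = 0 \<Longrightarrow> p = 0 \<and> q = 0 \<and> r = 0"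
  shows "joint_limit \<alpha> \<beta> (1 / 2)"
  unfolding joint_limit_def
proof (intro allI impI)
  fix \<epsilon> :: real assume "\<epsilon> > 0"
  interpret Z: Modules.module "\<lambda>r x. real_of_int r * x"
    by (simp add: Modules.module.intro distrib_left mult.commute)
  \<comment> \<open>The family has 1 as its last member, the form in which Kronecker's theorem is
    applied.\<close>
  define \<theta> :: "nat \<Rightarrow> real" where "\<theta> = (\<lambda>_. 1)(0 := \<alpha>, 1 := \<beta>)"
  have \<theta>: "\<theta> 0 = \<alpha>" "\<theta> 1 = \<beta>" "\<theta> 2 = 1" "\<theta> (Suc 0) = \<beta>" by (auto simp: \<theta>_def)
  have two: "{..2::nat} = {0, 1, 2}" by auto
  have dist: "\<alpha> \<noteq> \<beta>" "\<alpha> \<noteq> 1" "\<beta> \<noteq> 1"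
    using indep[of 1 "-1" 0] indep[of 1 0 "-1"] indep[of 0 1 "-1"] by auto
  have inj: "inj_on \<theta> {..2}" unfolding two using dist by (auto simp: \<theta>)
  have img: "\<theta> ` {..2} = {\<alpha>, \<beta>, 1}" unfolding two by (auto simp: \<theta>)
  have "Z.independent (\<theta> ` {..2})"
    unfolding img
  proof (subst Z.independent_explicit_module, intro allI impI)
    fix T u v
    assume T: "finite T" "T \<subseteq> {\<alpha>, \<beta>, 1}" "(\<Sum>v\<in>T. real_of_int (u v) * v) = 0" "v \<in> T"
    \<comment> \<open>Extending the coefficients by zero outside \<open>T\<close> gives a relation
      between all three numbers, to which \<open>indep\<close> applies.\<close>
    define w where "w = (\<lambda>v. if v \<in> T then u v else 0)"
    have "(\<Sum>v\<in>{\<alpha>, \<beta>, 1}. real_of_int (w v) * v) = (\<Sum>v\<in>T. real_of_int (w v) * v)"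
      using T(2) by (intro sum.mono_neutral_right) (auto simp: w_def)
    also have "\<dots> = 0" using T(3) by (simp add: w_def)
    finally have "of_int (w \<alpha>) * \<alpha> + of_int (w \<beta>) * \<beta> + of_int (w 1) = 0"
      using dist by simp
    then have "w \<alpha> = 0 \<and> w \<beta> = 0 \<and> w 1 = 0" by (rule indep)
    then have "w v = 0" using T by blast
    then show "u v = 0" using T by (simp add: w_def)
  qed
  then obtain k m where km: "\<And>i. i < 2 \<Longrightarrow> \<bar>of_int k * \<theta> i - of_int (m i) - (if i = 0 then 0 else 1 / 2)\<bar> < \<epsilon>"
    using Kronecker_thm_2[of \<theta> 2 \<epsilon> "\<lambda>i. if i = 0 then 0 else 1 / 2"] inj \<theta>(3) \<open>\<epsilon> > 0\<close> by blast
  have k0: "\<bar>of_int k * \<alpha> - of_int (m 0)\<bar> < \<epsilon>" and k1: "\<bar>of_int k * \<beta> - of_int (m 1) - 1 / 2\<bar> < \<epsilon>"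
    using km[of 0] km[of 1] by (simp_all add: \<theta>)
  show "\<exists>n::nat. \<exists>i j::int. \<bar>real n * \<alpha> - of_int i\<bar> < \<epsilon> \<and> \<bar>real n * \<beta> - of_int j - 1 / 2\<bar> < \<epsilon>"
  proof (cases "k \<ge> 0")
    case True
    with k0 k1 show ?thesis by (intro exI[of _ "nat k"] exI[of _ "m 0"] exI[of _ "m 1"]) simp
  next
    case False
    \<comment> \<open>Negation fixes the target, since \<open>-1/2 \<equiv> 1/2\<close> modulo 1.\<close>
    with k0 k1 show ?thesis
      by (intro exI[of _ "nat (- k)"] exI[of _ "- m 0"] exI[of _ "- m 1 - 1"])
        (simp add: algebra_simps abs_minus_commute abs_le_iff abs_less_iff)
  qed
qed

text \<open>If \<open>n * \<alpha>\<close> is near \<open>1 / q\<close> modulo 1, then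
  \<open>q * n * \<alpha>\<close> is near 0, while by \<open>rel\<close> the number
  \<open>q * n * \<beta>\<close> equals \<open>- p * (n * \<alpha>) - n * r\<close>, which is near
  \<open>- p / q\<close> modulo 1.\<close>

lemma joint_limit_transfer:
  assumes "\<alpha> \<notin> \<rat>" and "q > 0"
    and rel: "of_int p * \<alpha> + of_int q * \<beta> + of_int r = 0"
  shows "joint_limit \<alpha> \<beta> (- of_int p / of_int q)"
  unfolding joint_limit_def
proof (intro allI impI)
  fix \<epsilon> :: real assume "\<epsilon> > 0"
  \<comment> \<open>The error \<open>x\<close> is multiplied by \<open>q\<close> for \<alpha> and by
    \<open>- p\<close> for \<beta>; \<open>C\<close> dominates both factors.\<close>
  define C where "C = \<bar>real_of_int p\<bar> + real_of_int q"
  have "C > 0" using \<open>q > 0\<close> by (simp add: C_def add_nonneg_pos)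
  then have "\<epsilon> / C > 0" using \<open>\<epsilon> > 0\<close> by simp
  from dense_large_multiples[OF \<open>\<alpha> \<notin> \<rat>\<close> this, of 0 "1 / of_int q"]
  obtain n h where h: "\<bar>real n * \<alpha> - of_int h - 1 / of_int q\<bar> < \<epsilon> / C" by blast
  define x where "x = real n * \<alpha> - of_int h - 1 / of_int q"
  have x: "\<bar>x\<bar> * C < \<epsilon>" using h \<open>C > 0\<close> by (simp add: x_def field_simps)
  define N where "N = nat q * n"
  have N: "real N = of_int q * real n" using \<open>q > 0\<close> by (simp add: N_def)
  have "real N * \<alpha> - of_int (q * h + 1) = of_int q * x"
    using \<open>q > 0\<close> by (simp add: N x_def field_simps)
  moreover have "\<bar>of_int q * x\<bar> \<le> \<bar>x\<bar> * C"
    using \<open>q > 0\<close> by (simp add: abs_mult C_def algebra_simps)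
  ultimately have A: "\<bar>real N * \<alpha> - of_int (q * h + 1)\<bar> < \<epsilon>" using x by simp
  have "of_int q * \<beta> = - of_int p * \<alpha> - of_int r" using rel by simp
  then have "real N * \<beta> = real n * (- of_int p * \<alpha> - of_int r)"
    by (metis N mult.assoc mult.commute)
  then have "real N * \<beta> - of_int (- p * h - int n * r) - (- of_int p / of_int q) = - of_int p * x"
    using \<open>q > 0\<close> by (simp add: x_def field_simps)
  moreover have "\<bar>- of_int p * x\<bar> \<le> \<bar>x\<bar> * C"
    using \<open>q > 0\<close> by (simp add: abs_mult C_def algebra_simps)
  ultimately have "\<bar>real N * \<beta> - of_int (- p * h - int n * r) - (- of_int p / of_int q)\<bar> < \<epsilon>"
    using x by simp
  with A show "\<exists>n::nat. \<exists>i j::int. \<bar>real n * \<alpha> - of_int i\<bar> < \<epsilon> \<and>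
      \<bar>real n * \<beta> - of_int j - (- of_int p / of_int q)\<bar> < \<epsilon>" by blast
qed

text \<open>For \<open>N\<close> congruent to 1 modulo \<open>q\<close>, \<open>N * r / q\<close>
  agrees with \<open>r / q\<close> modulo 1. If \<open>N * \<alpha>\<close> is also near 0 modulo 1,
  so is \<open>m * (N * \<alpha>)\<close>, and only the constant term survives.\<close>

lemma joint_limit_constant:
  assumes "\<alpha> \<notin> \<rat>" and "q > 0"
    and \<beta>: "\<beta> = of_int m * \<alpha> - of_int r / of_int q"
  shows "joint_limit \<alpha> \<beta> (- of_int r / of_int q)"
  unfolding joint_limit_def
proof (intro allI impI)
  fix \<epsilon> :: real assume "\<epsilon> > 0"
  define C where "C = 1 + \<bar>real_of_int m\<bar>"
  have "C > 0" by (simp add: C_def add_pos_nonneg)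
  have "of_int q * \<alpha> \<notin> \<rat>"
  proof
    assume "of_int q * \<alpha> \<in> \<rat>"
    then have "of_int q * \<alpha> / of_int q \<in> \<rat>" by (intro Rats_divide) auto
    with assms show False by simp
  qed
  \<comment> \<open>With \<open>N = 1 + q * n\<close>, making \<open>N * \<alpha>\<close> nearly an
    integer means bringing \<open>n * (q * \<alpha>)\<close> close to \<open>- \<alpha>\<close>
    modulo 1.\<close>
  from dense_large_multiples[OF this, of "\<epsilon> / C" 0 "- \<alpha>"] \<open>\<epsilon> > 0\<close> \<open>C > 0\<close>
  obtain n h where h: "\<bar>real n * (of_int q * \<alpha>) - of_int h - - \<alpha>\<bar> < \<epsilon> / C" by auto
  define N where "N = 1 + nat q * n"
  have N: "real N = 1 + of_int q * real n" using \<open>q > 0\<close> by (simp add: N_def)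
  define x where "x = real N * \<alpha> - of_int h"
  have "\<bar>x\<bar> < \<epsilon> / C" using h by (simp add: x_def N algebra_simps)
  then have x: "\<bar>x\<bar> * C < \<epsilon>" using \<open>C > 0\<close> by (simp add: field_simps)
  have "\<bar>x\<bar> \<le> \<bar>x\<bar> * C" by (simp add: C_def algebra_simps)
  then have A: "\<bar>real N * \<alpha> - of_int h\<bar> < \<epsilon>" using x by (simp add: x_def)
  have "real N * \<beta> = of_int m * (real N * \<alpha>) - of_int r / of_int q - of_int r * real n"
    using \<open>q > 0\<close> by (simp add: \<beta> N field_simps)
  then have "real N * \<beta> - of_int (m * h - r * int n) - (- of_int r / of_int q) = of_int m * x"
    by (simp add: x_def algebra_simps)
  moreover have "\<bar>of_int m * x\<bar> \<le> \<bar>x\<bar> * C" by (simp add: abs_mult C_def algebra_simps)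
  ultimately have "\<bar>real N * \<beta> - of_int (m * h - r * int n) - (- of_int r / of_int q)\<bar> < \<epsilon>"
    using x by simp
  with A show "\<exists>n::nat. \<exists>i j::int. \<bar>real n * \<alpha> - of_int i\<bar> < \<epsilon> \<and>
      \<bar>real n * \<beta> - of_int j - (- of_int r / of_int q)\<bar> < \<epsilon>" by blast
qed

text \<open>Three candidate limits are tested in turn: excluding 1/2 yields an integer relation,
  integrality of \<open>- p' / q'\<close> gives the coefficient of \<alpha>, and integrality of
  \<open>- r' / q'\<close> gives the constant.\<close>

lemma trivial_joint_limits_imp_multiple:
  assumes "\<alpha> \<notin> \<rat>" and triv: "\<And>k. joint_limit \<alpha> \<beta> k \<Longrightarrow> k \<in> \<int>"
  obtains m l :: int where "\<beta> = of_int m * \<alpha> + of_int l"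
proof -
  have "(1 / 2 :: real) \<notin> \<int>"
    by (auto elim!: Ints_cases simp: field_simps simp flip: of_int_mult)
  then obtain p q r :: int where rel: "of_int p * \<alpha> + of_int q * \<beta> + of_int r = 0"
    and nz: "\<not> (p = 0 \<and> q = 0 \<and> r = 0)"
    using joint_limit_half triv by metis
  have "q \<noteq> 0"
  proof
    assume [simp]: "q = 0"
    show False
    proof (cases "p = 0")
      case True
      with rel nz show False by simp
    next
      case False
      then have "\<alpha> = of_int (- r) / of_int p" using rel by (simp add: field_simps)
      with \<open>\<alpha> \<notin> \<rat>\<close> show False by (metis Rats_divide Rats_of_int)
    qed
  qed
  then obtain p' q' r' :: int where "q' > 0"
    and rel': "of_int p' * \<alpha> + of_int q' * \<beta> + of_int r' = 0"
  proof (cases "q > 0")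
    case True
    with rel that show thesis by blast
  next
    case False
    with rel \<open>q \<noteq> 0\<close> that[of "- q" "- p" "- r"] show thesis by simp
  qed
  have "- of_int p' / of_int q' \<in> (\<int> :: real set)"
    using triv joint_limit_transfer[OF \<open>\<alpha> \<notin> \<rat>\<close> \<open>q' > 0\<close> rel'] by blast
  then obtain m where m: "- of_int p' / of_int q' = real_of_int m" by (rule Ints_cases)
  have \<beta>: "\<beta> = of_int m * \<alpha> - of_int r' / of_int q'"
    unfolding m[symmetric] using rel' \<open>q' > 0\<close> by (simp add: field_simps)
  \<comment> \<open>This limit comes second because it presupposes the integer coefficient
    \<open>m\<close>.\<close>
  have "- of_int r' / of_int q' \<in> (\<int> :: real set)"
    using triv joint_limit_constant[OF \<open>\<alpha> \<notin> \<rat>\<close> \<open>q' > 0\<close> \<beta>] by blast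
  then obtain l where "- of_int r' / of_int q' = real_of_int l" by (rule Ints_cases)
  with \<beta> have "\<beta> = of_int m * \<alpha> + of_int l" by simp
  then show thesis by (rule that)
qed

section \<open>Recovering the angle within [0, 1/2]\<close>

lemma irrational_affine_eq_0:
  fixes \<alpha> :: real
  assumes "\<alpha> \<notin> \<rat>" "of_int a * \<alpha> + of_int b = 0"
  shows "a = 0"
proof (rule ccontr)
  assume "a \<noteq> 0"
  then have "\<alpha> = of_int (- b) / of_int a" using assms(2) by (simp add: field_simps)
  with assms(1) show False by (metis Rats_divide Rats_of_int)
qed

text \<open>Substituting one relation into the other gives \<open>m' * m = 1\<close> by
  irrationality, so \<beta> is \<alpha> or its negative modulo 1; the range of the angles
  decides.\<close>

lemma mutual_multiples_eq:
  fixes \<alpha> \<beta> :: real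
  assumes \<alpha>: "\<alpha> \<in> {0..1/2} - \<rat>" and \<beta>: "\<beta> \<in> {0..1/2} - \<rat>"
    and \<beta>\<alpha>: "\<beta> = of_int m * \<alpha> + of_int l" and \<alpha>\<beta>: "\<alpha> = of_int m' * \<beta> + of_int l'"
  shows "\<alpha> = \<beta>"
proof -
  have "of_int (m' * m - 1) * \<alpha> + of_int (m' * l + l') = 0"
    using \<alpha>\<beta> unfolding \<beta>\<alpha> by (simp add: algebra_simps)
  then have "m' * m = 1" using irrational_affine_eq_0 \<alpha> by fastforce
  then have "m = 1 \<or> m = -1" by (metis dvd_triv_right zdvd1_eq abs_eq_iff abs_1)
  then show ?thesis
  proof
    assume "m = 1"
    \<comment> \<open>The integer \<open>l\<close> is the difference of two numbers in
      [0, 1/2].\<close>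
    with \<beta>\<alpha> \<alpha> \<beta> have "l = 0" by auto
    with \<beta>\<alpha> \<open>m = 1\<close> show ?thesis by simp
  next
    assume "m = -1"
    with \<beta>\<alpha> have eq: "\<alpha> + \<beta> = of_int l" by simp
    \<comment> \<open>Excluding the endpoints puts the sum strictly between 0 and 1, where there is
      no integer.\<close>
    have "\<alpha> \<noteq> 0" "\<alpha> \<noteq> 1/2" using \<alpha> by (metis DiffE Rats_0, metis DiffE Rats_1 Rats_divide Rats_number_of)
    with eq \<alpha> \<beta> have "0 < real_of_int l" "real_of_int l < 1" by auto
    then show ?thesis by simp
  qed
qed

section \<open>Itineraries\<close>

lemma itinerary_eq_iff:
  "itinerary \<alpha> I = itinerary \<beta> K \<longleftrightarrow>
    (\<forall>n. real n * \<alpha> \<in> proj_circle -` I \<longleftrightarrow> real n * \<beta> \<in> proj_circle -` K)"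
proof -
  have "(rotation \<gamma> ^^ n) (proj_circle 0) = proj_circle (real n * \<gamma>)" for \<gamma> n
    by (induction n) (auto simp: rotation_proj_circle algebra_simps)
  then show ?thesis by (auto simp: fun_eq_iff itinerary_def)
qed

text \<open>Orbit points are dense in the open set \<open>interior J\<close> and those in it lie in
  the closed set \<open>K\<close>; regularity of \<open>J\<close> extends the inclusion to all of
  \<open>J\<close>.\<close>

lemma same_orbit_subset:
  assumes J: "arc_lift J" and K: "arc_lift K" and "\<alpha> \<notin> \<rat>"
    and orbit: "\<And>n. real n * \<alpha> \<in> J \<Longrightarrow> real n * \<alpha> \<in> K"
  shows "J \<subseteq> K"
proof -
  have "y \<in> K" if y: "y \<in> interior J" for y
  proof -
    obtain d where "d > 0" and d: "\<And>z. dist z y < d \<Longrightarrow> z \<in> J"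
      by (metis y mem_interior dist_commute mem_ball subsetD)
    have "\<exists>z\<in>K. dist z y < e" if "e > 0" for e
    proof -
      obtain n h where h: "\<bar>real n * \<alpha> - of_int h - y\<bar> < min d e"
        using dense_large_multiples[OF \<open>\<alpha> \<notin> \<rat>\<close>, of "min d e" 0 y] \<open>d > 0\<close> \<open>e > 0\<close> by auto
      have dist: "dist (real n * \<alpha> + of_int (- h)) y < min d e"
        using h by (simp add: dist_real_def algebra_simps)
      then have "real n * \<alpha> + of_int (- h) \<in> J" by (intro d) simp
      then have "real n * \<alpha> + of_int (- h) \<in> K"
        using orbit arc_lift_periodic[OF J] arc_lift_periodic[OF K] by blast
      with dist show ?thesis by auto
    qed
    then show ?thesis using K closed_approachable unfolding arc_lift_def by blast
  qed
  then have "closure (interior J) \<subseteq> K"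
    using K by (intro closure_minimal) (auto simp: arc_lift_def)
  then show ?thesis using J unfolding arc_lift_def by blast
qed

lemma itinerary_eq_imp_multiple:
  assumes "\<alpha> \<notin> \<rat>" "\<beta> \<notin> \<rat>" "finite_union_of_fat_arcs I"
    and K: "finite_union_of_fat_arcs K" "K \<noteq> {}" "K \<noteq> UNIV" "no_rotational_symmetries K"
    and eq: "itinerary \<alpha> I = itinerary \<beta> K"
  obtains m l :: int where "\<beta> = of_int m * \<alpha> + of_int l"
proof (rule trivial_joint_limits_imp_multiple[OF \<open>\<alpha> \<notin> \<rat>\<close>])
  fix k assume k: "joint_limit \<alpha> \<beta> k"
  have "x + k \<in> proj_circle -` K" if "x \<in> proj_circle -` K" for x
    using eq that k assms(1-4) unfolding itinerary_eq_iff
    by (intro translation_closed[of "proj_circle -` I" "proj_circle -` K" \<alpha> \<beta>] arc_lift_vimage) auto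
  then show "k \<in> \<int>" by (rule translation_integer[OF K])
qed (use that in blast)

theorem theorem1:
  fixes \<alpha>1 \<alpha>2 :: real and I1 I2 :: "circle set"
  assumes "\<alpha>1 \<in> {0..1/2} - \<rat>" and "\<alpha>2 \<in> {0..1/2} - \<rat>"
    and "finite_union_of_fat_arcs I1" and "finite_union_of_fat_arcs I2"
    and "I1 \<noteq> {}" and "I1 \<noteq> UNIV"
    and "I2 \<noteq> {}" and "I2 \<noteq> UNIV"
    and "no_rotational_symmetries I1" and "no_rotational_symmetries I2"
  shows "itinerary \<alpha>1 I1 = itinerary \<alpha>2 I2 \<longleftrightarrow> \<alpha>1 = \<alpha>2 \<and> I1 = I2"
proof
  assume eq: "itinerary \<alpha>1 I1 = itinerary \<alpha>2 I2"
  have irr: "\<alpha>1 \<notin> \<rat>" "\<alpha>2 \<notin> \<rat>" using assms by auto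
  obtain m l :: int where ml: "\<alpha>2 = of_int m * \<alpha>1 + of_int l"
    using itinerary_eq_imp_multiple[OF irr assms(3,4,7,8,10) eq] .
  \<comment> \<open>Exchanging the two rotations gives the reverse relation.\<close>
  obtain m' l' :: int where ml': "\<alpha>1 = of_int m' * \<alpha>2 + of_int l'"
    using itinerary_eq_imp_multiple[OF irr(2,1) assms(4,3,5,6,9) eq[symmetric]] .
  have \<alpha>: "\<alpha>1 = \<alpha>2" by (rule mutual_multiples_eq[OF assms(1,2) ml ml'])
  \<comment> \<open>With equal angles both lifts contain the same points of one dense orbit, which
    determines them.\<close>
  have "proj_circle -` I1 = proj_circle -` I2"
    using eq unfolding itinerary_eq_iff \<alpha>
    by (intro equalityI same_orbit_subset[OF _ _ irr(2)] arc_lift_vimage assms) auto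
  then have "I1 = I2" using surj_proj_circle by (metis surj_image_vimage_eq)
  with \<alpha> show "\<alpha>1 = \<alpha>2 \<and> I1 = I2" ..
qed simp

end
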